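(* Let $\mathcal E$ be a regular Dirichlet form on $L^2(X,m)$ with domain $\mathcal D$. Let $u_n,u\in\mathcal D\cap L^\infty(X)$ ($n\in\mathbb N$) and $v\in\mathcal D$ be given such that $\|u_n\|_\infty$ is bounded in $n$ and $u_n\to u$ weakly in the Hilbert space $(\mathcal D,\mathcal E_1)$. Then, for each $*\in\{a,b,c,d\}$, the measures $\mu^{( * )}(u_n,v)$ converge vaguely to $\mu^{( * )}(u,v)$, i.e. $$\int f\,d\mu^{( * )}(u_n,v)\to\int f\,d\mu^{( * )}(u,v)\qquad\text{for all } f\in C_c(X).$$
   Context: Setting. $X$ is a locally compact separable metric space, $m$ a positive Radon measure on $X$ with $\operatorname{supp} m=X$; all functions are real valued; $C_c(X)$ is the set of continuous compactly supported functions. $\mathcal E:\mathcal D\times\mathcal D\to\mathbb R$, with $\mathcal D$ dense in $L^2(X,m)$, is a regular (symmetric) Dirichlet form: it is closed, non-negative, $\mathcal E(T\circ u,T\circ u)\le\mathcal E(u,u)$ for all normal contractions $T$, and $\mathcal D\cap C_c(X)$ is dense in $\mathcal D$ with respect to $\sqrt{\mathcal E_1}$ and in $C_c(X)$ with respect to $\|\cdot\|_\infty$. Here $\mathcal E_1(u,v)=\mathcal E(u,v)+(u,v)_{L^2}$. For bilinear $q$ write $q(u):=q(u,u)$. $\tilde u$ denotes a quasi-continuous representative of $u\in\mathcal D$. Beurling–Deny formula: with $d=\{(x,x):x\in X\}$, there are a non-negative Radon measure $k$ on $X$, a non-negative symmetric Radon measure $J$ on $X\times X\setminus d$, and a positive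 semidefinite bilinear form $\mu^{(c)}$ on $\mathcal D$ with values in the signed Radon measures on $X$, strongly local (i.e. $\mu^{(c)}(u,v)=0$ if $u$ is constant on $\operatorname{supp}v$), such that for $u\in\mathcal D$ $$\mathcal E(u)=\int_{X\times X\setminus d}(\tilde u(x)-\tilde u(y))^2\,J(dx,dy)+\int_X d\mu^{(c)}(u)+\int_X\tilde u^2\,dk.$$ The measures $\mu^{(b)},\mu^{(a)},\mu^{(d)}$ are given (with polarization) by $\mu^{(b)}(u,v)(K)=\int_{K\times X\setminus d}(\tilde u(x)-\tilde u(y))(\tilde v(x)-\tilde v(y))\,J(dx,dy)$, $\mu^{(a)}(u,v)(K)=\int_K\tilde u\tilde v\,dk$ for compact $K\subset X$, and $\mu^{(d)}=\mu^{(b)}+\mu^{(c)}$. *)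

theory Defs
  imports "HOL-Probability.Essential_Supremum"
begin

text \<open>Elements of \<open>L\<^sup>2(X,m)\<close> are represented by Borel functions; domains and forms are required to be
  invariant under \<open>m\<close>-a.e. equality (\<open>dirichlet_form\<close>), so that they live on classes.\<close>

definition C_c :: "('a::topological_space \<Rightarrow> real) set" where
  "C_c = {f. continuous_on UNIV f \<and> compact (closure {x. f x \<noteq> 0})}"

definition diag :: "('a \<times> 'a) set" where
  "diag = {(x, x) | x. True}"

text \<open>Radon measures on a locally compact subset \<open>S\<close> of the ambient space, as Borel measures with
  carrier \<open>S\<close>; used with \<open>S = UNIV\<close> and with \<open>S = X \<times> X - diag\<close>.\<close>

definition radon_measure_on :: "'a::topological_space set \<Rightarrow> 'a measure \<Rightarrow> bool" where
  "radon_measure_on S M \<longleftrightarrow>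
     sets M = sets (restrict_space borel S) \<and>
     (\<forall>K. compact K \<and> K \<subseteq> S \<longrightarrow> emeasure M K < \<infinity>) \<and>
     (\<forall>B\<in>sets M. emeasure M B = (SUP K\<in>{K. compact K \<and> K \<subseteq> B}. emeasure M K))"

definition full_support :: "'a::topological_space measure \<Rightarrow> bool" where
  "full_support M \<longleftrightarrow> (\<forall>U. open U \<and> U \<noteq> {} \<longrightarrow> emeasure M U > 0)"


subsection \<open>Signed Radon measures\<close>

text \<open>A signed Radon measure need not have finite total variation, so it is a real valued function on
  the relatively compact Borel sets; its values on all other sets carry no information.\<close>

definition rc_borel :: "'a::topological_space set set" where
  "rc_borel = {B \<in> sets borel. compact (closure B)}"

definition signed_radon_measure :: "('a::topological_space set \<Rightarrow> real) \<Rightarrow> bool" where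
  "signed_radon_measure \<mu> \<longleftrightarrow>
     (\<exists>\<nu>\<^sub>1 \<nu>\<^sub>2. radon_measure_on UNIV \<nu>\<^sub>1 \<and> radon_measure_on UNIV \<nu>\<^sub>2 \<and>
        (\<forall>B\<in>rc_borel. \<mu> B = measure \<nu>\<^sub>1 B - measure \<nu>\<^sub>2 B))"

text \<open>Jordan decomposition: \<open>\<mu>\<^sup>+ A = sup {\<mu> B | B \<subseteq> A}\<close> and \<open>\<mu>\<^sup>- = (-\<mu>)\<^sup>+\<close>. If \<open>\<mu>\<close> is non-negative,
  \<open>pos_variation \<mu>\<close> is \<open>\<mu>\<close> itself, extended to all Borel sets.\<close>

definition pos_variation :: "('a::topological_space set \<Rightarrow> real) \<Rightarrow> 'a measure" where
  "pos_variation \<mu> =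
     measure_of UNIV (sets borel) (\<lambda>A. SUP B\<in>{B\<in>rc_borel. B \<subseteq> A}. ennreal (\<mu> B))"

definition neg_variation :: "('a::topological_space set \<Rightarrow> real) \<Rightarrow> 'a measure" where
  "neg_variation \<mu> = pos_variation (\<lambda>B. - \<mu> B)"

definition signed_integral :: "('a::topological_space set \<Rightarrow> real) \<Rightarrow> ('a \<Rightarrow> real) \<Rightarrow> real" where
  "signed_integral \<mu> f = (\<integral>x. f x \<partial>pos_variation \<mu>) - (\<integral>x. f x \<partial>neg_variation \<mu>)"

definition vaguely_converges ::
  "(nat \<Rightarrow> 'a::topological_space set \<Rightarrow> real) \<Rightarrow> ('a set \<Rightarrow> real) \<Rightarrow> bool" where
  "vaguely_converges \<mu>s \<mu> \<longleftrightarrow>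
     (\<forall>f\<in>C_c. (\<lambda>n. signed_integral (\<mu>s n) f) \<longlonglongrightarrow> signed_integral \<mu> f)"


subsection \<open>Regular Dirichlet forms\<close>

definition L2 :: "'a measure \<Rightarrow> ('a \<Rightarrow> real) set" where
  "L2 m = {u \<in> borel_measurable m. integrable m (\<lambda>x. (u x)\<^sup>2)}"

definition form1 ::
  "'a measure \<Rightarrow> (('a \<Rightarrow> real) \<Rightarrow> ('a \<Rightarrow> real) \<Rightarrow> real) \<Rightarrow> ('a \<Rightarrow> real) \<Rightarrow> ('a \<Rightarrow> real) \<Rightarrow> real" where
  "form1 m E u v = E u v + (\<integral>x. u x * v x \<partial>m)"

definition norm1 ::
  "'a measure \<Rightarrow> (('a \<Rightarrow> real) \<Rightarrow> ('a \<Rightarrow> real) \<Rightarrow> real) \<Rightarrow> ('a \<Rightarrow> real) \<Rightarrow> real" where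
  "norm1 m E u = sqrt (form1 m E u u)"

definition normal_contraction :: "(real \<Rightarrow> real) \<Rightarrow> bool" where
  "normal_contraction T \<longleftrightarrow> T 0 = 0 \<and> (\<forall>s t. \<bar>T s - T t\<bar> \<le> \<bar>s - t\<bar>)"

definition dirichlet_form ::
  "'a measure \<Rightarrow> ('a \<Rightarrow> real) set \<Rightarrow> (('a \<Rightarrow> real) \<Rightarrow> ('a \<Rightarrow> real) \<Rightarrow> real) \<Rightarrow> bool" where
  "dirichlet_form m D E \<longleftrightarrow>
     \<comment> \<open>dense subspace of \<open>L\<^sup>2\<close>\<close>
     D \<subseteq> L2 m \<and> (\<lambda>_. 0) \<in> D \<and>
     (\<forall>u\<in>D. \<forall>v\<in>D. \<forall>a b. (\<lambda>x. a * u x + b * v x) \<in> D) \<and>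
     (\<forall>f\<in>L2 m. \<forall>e>0. \<exists>u\<in>D. sqrt (\<integral>x. (f x - u x)\<^sup>2 \<partial>m) < e) \<and>
     \<comment> \<open>invariance under a.e. equality\<close>
     (\<forall>u\<in>D. \<forall>u'\<in>borel_measurable m. (AE x in m. u x = u' x) \<longrightarrow>
        u' \<in> D \<and> (\<forall>v\<in>D. E u v = E u' v)) \<and>
     \<comment> \<open>non-negative symmetric bilinear form\<close>
     (\<forall>u\<in>D. \<forall>v\<in>D. E u v = E v u) \<and>
     (\<forall>u\<in>D. \<forall>v\<in>D. \<forall>w\<in>D. \<forall>a b. E (\<lambda>x. a * u x + b * v x) w = a * E u w + b * E v w) \<and>
     (\<forall>u\<in>D. 0 \<le> E u u) \<and>
     \<comment> \<open>closedness\<close>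
     (\<forall>s. (\<forall>n. s n \<in> D) \<and>
          (\<forall>e>0. \<exists>N::nat. \<forall>i\<ge>N. \<forall>j\<ge>N. norm1 m E (\<lambda>x. s i x - s j x) < e) \<longrightarrow>
          (\<exists>u\<in>D. (\<lambda>n. norm1 m E (\<lambda>x. s n x - u x)) \<longlonglongrightarrow> 0)) \<and>
     \<comment> \<open>normal contractions operate\<close>
     (\<forall>T. normal_contraction T \<longrightarrow> (\<forall>u\<in>D. T \<circ> u \<in> D \<and> E (T \<circ> u) (T \<circ> u) \<le> E u u))"

definition regular_dirichlet_form ::
  "'a::topological_space measure \<Rightarrow> ('a \<Rightarrow> real) set \<Rightarrow>
   (('a \<Rightarrow> real) \<Rightarrow> ('a \<Rightarrow> real) \<Rightarrow> real) \<Rightarrow> bool" where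
  "regular_dirichlet_form m D E \<longleftrightarrow>
     dirichlet_form m D E \<and>
     (\<forall>u\<in>D. \<forall>e>0. \<exists>g\<in>D \<inter> C_c. norm1 m E (\<lambda>x. u x - g x) < e) \<and>
     (\<forall>f\<in>C_c. \<forall>e>0. \<exists>g\<in>D \<inter> C_c. \<forall>x. \<bar>f x - g x\<bar> < e)"

definition Linf_norm :: "'a measure \<Rightarrow> ('a \<Rightarrow> real) \<Rightarrow> ereal" where
  "Linf_norm m u = esssup m (\<lambda>x. ereal \<bar>u x\<bar>)"

definition weakly_converges ::
  "'a measure \<Rightarrow> ('a \<Rightarrow> real) set \<Rightarrow> (('a \<Rightarrow> real) \<Rightarrow> ('a \<Rightarrow> real) \<Rightarrow> real) \<Rightarrow>
   (nat \<Rightarrow> 'a \<Rightarrow> real) \<Rightarrow> ('a \<Rightarrow> real) \<Rightarrow> bool" where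
  "weakly_converges m D E us u \<longleftrightarrow>
     (\<forall>\<phi>. (\<forall>v\<in>D. \<forall>w\<in>D. \<forall>a b. \<phi> (\<lambda>x. a * v x + b * w x) = a * \<phi> v + b * \<phi> w) \<and>
          (\<exists>C::real. \<forall>v\<in>D. \<bar>\<phi> v\<bar> \<le> C * norm1 m E v) \<longrightarrow>
          (\<lambda>n. \<phi> (us n)) \<longlonglongrightarrow> \<phi> u)"

text \<open>The capacity of an open set; the infimum of the empty set is \<open>\<infinity>\<close>.\<close>

definition open_capacity ::
  "'a measure \<Rightarrow> ('a \<Rightarrow> real) set \<Rightarrow> (('a \<Rightarrow> real) \<Rightarrow> ('a \<Rightarrow> real) \<Rightarrow> real) \<Rightarrow> 'a set \<Rightarrow> ennreal" where
  "open_capacity m D E U =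
     (INF u\<in>{u\<in>D. AE x in m. x \<in> U \<longrightarrow> 1 \<le> u x}. ennreal (form1 m E u u))"

definition quasi_continuous ::
  "'a::topological_space measure \<Rightarrow> ('a \<Rightarrow> real) set \<Rightarrow>
   (('a \<Rightarrow> real) \<Rightarrow> ('a \<Rightarrow> real) \<Rightarrow> real) \<Rightarrow> ('a \<Rightarrow> real) \<Rightarrow> bool" where
  "quasi_continuous m D E g \<longleftrightarrow>
     (\<forall>e>0. \<exists>G. open G \<and> open_capacity m D E G < ennreal e \<and> continuous_on (- G) g)"

text \<open>Quasi-continuous functions are only determined up to sets of capacity zero; the representatives
  are taken to be everywhere defined and Borel, so that they can be integrated.\<close>

definition qc_representative ::
  "'a::topological_space measure \<Rightarrow> ('a \<Rightarrow> real) set \<Rightarrow>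
   (('a \<Rightarrow> real) \<Rightarrow> ('a \<Rightarrow> real) \<Rightarrow> real) \<Rightarrow> ('a \<Rightarrow> real) \<Rightarrow> ('a \<Rightarrow> real) \<Rightarrow> bool" where
  "qc_representative m D E u g \<longleftrightarrow>
     g \<in> borel_measurable borel \<and> quasi_continuous m D E g \<and> (AE x in m. g x = u x)"


subsection \<open>The Beurling--Deny representation\<close>

definition ae_supp :: "'a::topological_space measure \<Rightarrow> ('a \<Rightarrow> real) \<Rightarrow> 'a set" where
  "ae_supp m v = - \<Union>{U. open U \<and> (AE x in m. x \<in> U \<longrightarrow> v x = 0)}"

definition measure_valued_form ::
  "'a::topological_space measure \<Rightarrow> ('a \<Rightarrow> real) set \<Rightarrow>
   (('a \<Rightarrow> real) \<Rightarrow> ('a \<Rightarrow> real) \<Rightarrow> 'a set \<Rightarrow> real) \<Rightarrow> bool" where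
  "measure_valued_form m D \<mu> \<longleftrightarrow>
     (\<forall>u\<in>D. \<forall>v\<in>D. signed_radon_measure (\<mu> u v)) \<and>
     (\<forall>u\<in>D. \<forall>u'\<in>D. \<forall>v\<in>D. (AE x in m. u x = u' x) \<longrightarrow> (\<forall>B\<in>rc_borel. \<mu> u v B = \<mu> u' v B)) \<and>
     (\<forall>u\<in>D. \<forall>v\<in>D. \<forall>B\<in>rc_borel. \<mu> u v B = \<mu> v u B) \<and>
     (\<forall>u\<in>D. \<forall>v\<in>D. \<forall>w\<in>D. \<forall>a b. \<forall>B\<in>rc_borel.
        \<mu> (\<lambda>x. a * u x + b * v x) w B = a * \<mu> u w B + b * \<mu> v w B) \<and>
     (\<forall>u\<in>D. \<forall>B\<in>rc_borel. 0 \<le> \<mu> u u B)"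

definition strongly_local ::
  "'a::topological_space measure \<Rightarrow> ('a \<Rightarrow> real) set \<Rightarrow>
   (('a \<Rightarrow> real) \<Rightarrow> ('a \<Rightarrow> real) \<Rightarrow> 'a set \<Rightarrow> real) \<Rightarrow> bool" where
  "strongly_local m D \<mu> \<longleftrightarrow>
     (\<forall>u\<in>D. \<forall>v\<in>D. (\<exists>c. AE x in m. x \<in> ae_supp m v \<longrightarrow> u x = c) \<longrightarrow> (\<forall>B\<in>rc_borel. \<mu> u v B = 0))"

text \<open>The formula is required for every quasi-continuous representative \<open>g\<close> of \<open>u\<close>: its value does not
  depend on the choice, as \<open>k\<close> and \<open>J\<close> do not charge sets of capacity zero. The integrals are
  taken in \<open>[0,\<infinity>]\<close>, so the equation contains their finiteness.\<close>

definition beurling_deny ::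
  "'a::{metric_space, second_countable_topology} measure \<Rightarrow> ('a \<Rightarrow> real) set \<Rightarrow>
   (('a \<Rightarrow> real) \<Rightarrow> ('a \<Rightarrow> real) \<Rightarrow> real) \<Rightarrow> 'a measure \<Rightarrow> ('a \<times> 'a) measure \<Rightarrow>
   (('a \<Rightarrow> real) \<Rightarrow> ('a \<Rightarrow> real) \<Rightarrow> 'a set \<Rightarrow> real) \<Rightarrow> bool" where
  "beurling_deny m D E k J \<mu>c \<longleftrightarrow>
     radon_measure_on UNIV k \<and>
     radon_measure_on (UNIV - diag) J \<and> distr J J (\<lambda>(x, y). (y, x)) = J \<and>
     measure_valued_form m D \<mu>c \<and> strongly_local m D \<mu>c \<and>
     (\<forall>u\<in>D. \<forall>g. qc_representative m D E u g \<longrightarrow>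
        ennreal (E u u) =
          (\<integral>\<^sup>+(x, y). ennreal ((g x - g y)\<^sup>2) \<partial>J) +
          emeasure (pos_variation (\<mu>c u u)) UNIV +
          (\<integral>\<^sup>+x. ennreal ((g x)\<^sup>2) \<partial>k))"

text \<open>In the following definitions \<open>qc u\<close> is the chosen quasi-continuous representative of \<open>u\<close>.\<close>

definition mu_b ::
  "('a \<times> 'a) measure \<Rightarrow> (('a \<Rightarrow> real) \<Rightarrow> 'a \<Rightarrow> real) \<Rightarrow> ('a \<Rightarrow> real) \<Rightarrow> ('a \<Rightarrow> real) \<Rightarrow> 'a set \<Rightarrow> real" where
  "mu_b J qc u v B =
     (LINT z:B \<times> UNIV - diag|J. (qc u (fst z) - qc u (snd z)) * (qc v (fst z) - qc v (snd z)))"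

definition mu_a ::
  "'a measure \<Rightarrow> (('a \<Rightarrow> real) \<Rightarrow> 'a \<Rightarrow> real) \<Rightarrow> ('a \<Rightarrow> real) \<Rightarrow> ('a \<Rightarrow> real) \<Rightarrow> 'a set \<Rightarrow> real" where
  "mu_a k qc u v B = (LINT x:B|k. qc u x * qc v x)"

definition mu_d ::
  "('a \<times> 'a) measure \<Rightarrow> (('a \<Rightarrow> real) \<Rightarrow> ('a \<Rightarrow> real) \<Rightarrow> 'a set \<Rightarrow> real) \<Rightarrow>
   (('a \<Rightarrow> real) \<Rightarrow> 'a \<Rightarrow> real) \<Rightarrow> ('a \<Rightarrow> real) \<Rightarrow> ('a \<Rightarrow> real) \<Rightarrow> 'a set \<Rightarrow> real" where
  "mu_d J \<mu>c qc u v B = mu_b J qc u v B + \<mu>c u v B"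

end

theory Submission
  imports Defs
begin

text \<open>
  The convergence is weak convergence in \<open>(\<D>, E\<^sub>1)\<close> tested on one functional. For \<open>f \<in> C_c\<close> and
  \<open>v \<in> \<D>\<close> put \<open>Q(w, v) = \<integral> f d\<mu>(w, v)\<close>, where \<open>\<mu>\<close> is one of the measures of types a, b, c.
  Then \<open>Q\<close> is a symmetric bilinear form on \<open>\<D>\<close>. Since \<open>\<mu>(w, w)\<close> is non-negative and, by the
  Beurling--Deny formula, of total mass at most \<open>E(w, w)\<close>, the diagonal obeys
  \<open>|Q(w, w)| \<le> \<parallel>f\<parallel>\<^sub>\<infinity> E(w, w)\<close>. Polarization turns this into a bound
  \<open>|Q(w, v)| \<le> C \<parallel>w\<parallel>\<^sub>1\<close> (\<open>dominated_bilinear_bounded\<close>), so that \<open>w \<mapsto> Q(w, v)\<close> is a bounded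
  linear functional, and \<open>Q(u\<^sub>n, v) \<rightarrow> Q(u, v)\<close>; this is \<open>dominated_form_vague_convergence\<close>.
  Type d follows by adding types b and c.

  Two points make the linearity of \<open>Q\<close> more than a formality.

  First, the integral against a signed set function is defined through its Jordan decomposition,
  which is not linear. Any two of the signed set functions in question are given by densities with
  respect to one common measure, by Radon--Nikodym (\<open>common_density\<close>). The Jordan decomposition of
  a set function with density \<open>h\<close> is given by the positive and the negative part of \<open>h\<close>
  (\<open>pos_variation_density\<close>), the integral is that of \<open>f h\<close>, and densities do depend linearly on the
  set function (\<open>signed_integral_linear\<close>).

  Secondly, for types a and b the measure \<open>\<mu>(w, v)\<close> involves a choice of quasi-continuous
  representatives, and the representative chosen for a linear combination need not be the
  combination of the chosen representatives. The Beurling--Deny formula itself shows that the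
  measures cannot tell them apart (\<open>qc_representatives_agree\<close>): if \<open>g\<close> and \<open>h\<close> represent the same
  element, then so does \<open>(g + h) / 2\<close>, hence the sum of jump and killing energy has the same
  finite value for all three, and by the parallelogram identity it vanishes for \<open>(g - h) / 2\<close>.
\<close>

section \<open>Signed set functions and their densities\<close>

lemma rc_borel_subset: "B \<in> rc_borel \<Longrightarrow> A \<subseteq> B \<Longrightarrow> A \<in> sets borel \<Longrightarrow> A \<in> rc_borel"
  unfolding rc_borel_def
  by (auto intro: compact_Int_closed[of "closure B" "closure A", THEN back_subst[of compact]]
      dest: closure_mono)

lemma rc_borel_UN: "finite I \<Longrightarrow> (\<And>i. i \<in> I \<Longrightarrow> B i \<in> rc_borel) \<Longrightarrow> (\<Union>i\<in>I. B i) \<in> rc_borel"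
  by (induction I rule: finite_induct) (auto simp: rc_borel_def)

text \<open>Relatively compact open sets cover the space by local compactness, and countably many of them
  suffice by the Lindeloef property.\<close>

lemma rc_borel_exhaustion:
  assumes "locally compact (UNIV :: 'a::{metric_space, second_countable_topology} set)"
  obtains K :: "nat \<Rightarrow> 'a::{metric_space, second_countable_topology} set"
  where "incseq K" "\<And>n. K n \<in> rc_borel" "(\<Union>n. K n) = UNIV"
proof -
  define \<U> where "\<U> = {U :: 'a set. open U \<and> compact (closure U)}"
  have cov: "\<Union>\<U> = UNIV"
  proof (intro UNIV_eq_I[symmetric])
    fix x :: 'a
    obtain U V where UV: "open U" "compact V" "x \<in> U" "U \<subseteq> V"
      using assms unfolding locally_def by (metis UNIV_I openin_subtopology_self open_openin
          subtopology_UNIV top_greatest)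
    then have "compact (closure U)"
      using compact_Int_closed[of V "closure U"] closure_minimal[of U V] compact_imp_closed[of V]
      by (simp add: Int_absorb1)
    with UV show "x \<in> \<Union>\<U>" unfolding \<U>_def by auto
  qed
  obtain \<V> where \<V>: "\<V> \<subseteq> \<U>" "countable \<V>" "\<Union>\<V> = \<Union>\<U>"
    by (rule Lindelof[of \<U>]) (auto simp: \<U>_def)
  then have ne: "\<V> \<noteq> {}" using cov by auto
  define K where "K n = (\<Union>i\<le>n. from_nat_into \<V> i)" for n
  have "from_nat_into \<V> i \<in> rc_borel" for i
    using from_nat_into[OF ne, of i] \<V>(1) by (auto simp: \<U>_def rc_borel_def)
  then have "K n \<in> rc_borel" for n unfolding K_def by (intro rc_borel_UN) auto
  moreover have "incseq K" unfolding K_def incseq_def by (intro allI impI UN_mono) auto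
  moreover have "(\<Union>n. K n) = \<Union>(range (from_nat_into \<V>))"
    unfolding K_def by auto
  then have "(\<Union>n. K n) = \<Union>\<V>" by (simp only: range_from_nat_into[OF ne \<V>(2)])
  ultimately show ?thesis using that cov \<V>(3) by metis
qed

definition locally_finite_borel :: "'a::topological_space measure \<Rightarrow> bool" where
  "locally_finite_borel \<nu> \<longleftrightarrow> sets \<nu> = sets borel \<and> (\<forall>B\<in>rc_borel. emeasure \<nu> B < \<infinity>)"

text \<open>Locally finite Borel measures take the place of Radon measures here because they are visibly
  closed under the images and integrable weights from which \<open>mu_a\<close> and \<open>mu_b\<close> arise.\<close>

definition signed_borel :: "('a::topological_space set \<Rightarrow> real) \<Rightarrow> bool" where
  "signed_borel \<mu> \<longleftrightarrow>
     (\<exists>\<nu>\<^sub>1 \<nu>\<^sub>2. locally_finite_borel \<nu>\<^sub>1 \<and> locally_finite_borel \<nu>\<^sub>2 \<and>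
        (\<forall>B\<in>rc_borel. \<mu> B = measure \<nu>\<^sub>1 B - measure \<nu>\<^sub>2 B))"

definition has_density ::
  "('a::topological_space set \<Rightarrow> real) \<Rightarrow> 'a measure \<Rightarrow> ('a \<Rightarrow> real) \<Rightarrow> bool" where
  "has_density \<mu> \<nu> h \<longleftrightarrow> sets \<nu> = sets borel \<and> h \<in> borel_measurable borel \<and>
     (\<forall>B\<in>rc_borel. set_integrable \<nu> B h \<and> \<mu> B = (LINT x:B|\<nu>. h x))"

lemma radon_imp_locally_finite:
  "radon_measure_on UNIV \<nu> \<Longrightarrow> locally_finite_borel \<nu>"
proof -
  assume R: "radon_measure_on UNIV \<nu>"
  then have sets: "sets \<nu> = sets borel" by (simp add: radon_measure_on_def)
  have "emeasure \<nu> B < \<infinity>" if "B \<in> rc_borel" for B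
  proof -
    have "emeasure \<nu> B \<le> emeasure \<nu> (closure B)"
      by (intro emeasure_mono closure_subset) (simp add: sets)
    also have "\<dots> < \<infinity>"
      using R that unfolding radon_measure_on_def rc_borel_def by blast
    finally show ?thesis .
  qed
  with sets show ?thesis by (simp add: locally_finite_borel_def)
qed

lemma signed_radon_imp_signed_borel: "signed_radon_measure \<mu> \<Longrightarrow> signed_borel \<mu>"
  unfolding signed_radon_measure_def signed_borel_def using radon_imp_locally_finite by blast

lemma sigma_finite_locally_finite_borel:
  fixes \<nu> :: "'a::{metric_space, second_countable_topology} measure"
  assumes lc: "locally compact (UNIV :: 'a set)" and \<nu>: "locally_finite_borel \<nu>"
  shows "sigma_finite_measure \<nu>"
proof -
  obtain K :: "nat \<Rightarrow> 'a set" where K: "\<And>n. K n \<in> rc_borel" "(\<Union>n. K n) = UNIV"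
    using rc_borel_exhaustion[OF lc] by metis
  have "space \<nu> = UNIV"
    using \<nu> sets_eq_imp_space_eq[of \<nu> borel] by (simp add: locally_finite_borel_def)
  with K \<nu> show ?thesis
    by (intro sigma_finite_measure.intro exI[of _ "range K"])
      (auto simp: locally_finite_borel_def rc_borel_def less_top)
qed

text \<open>The sum dominates each of its members, so that all of them have densities with respect to it.\<close>

lemma finite_sum_locally_finite_borel:
  fixes \<N> :: "'a::topological_space measure set"
  assumes "finite \<N>" and \<N>: "\<And>N. N \<in> \<N> \<Longrightarrow> locally_finite_borel N"
  obtains \<nu> where "locally_finite_borel \<nu>"
    "\<And>A. A \<in> sets borel \<Longrightarrow> emeasure \<nu> A = (\<Sum>N\<in>\<N>. emeasure N A)"
proof -
  have sets: "sets N = sets borel" if "N \<in> \<N>" for N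
    using \<N>[OF that] by (simp add: locally_finite_borel_def)
  define \<nu> where "\<nu> = measure_of UNIV (sets (borel :: 'a measure)) (\<lambda>A. \<Sum>N\<in>\<N>. emeasure N A)"
  have em: "emeasure \<nu> A = (\<Sum>N\<in>\<N>. emeasure N A)" if A: "A \<in> sets borel" for A
    unfolding \<nu>_def
  proof (rule emeasure_measure_of_sigma)
    show "sigma_algebra UNIV (sets (borel :: 'a measure))"
      using sets.sigma_algebra_axioms[of "borel :: 'a measure"] by simp
    show "countably_additive (sets borel) (\<lambda>A. \<Sum>N\<in>\<N>. emeasure N A)"
    proof (rule countably_additiveI)
      fix A :: "nat \<Rightarrow> 'a set"
      assume "range A \<subseteq> sets borel" "disjoint_family A"
      then have "(\<Sum>N\<in>\<N>. emeasure N (\<Union>i. A i)) = (\<Sum>N\<in>\<N>. \<Sum>i. emeasure N (A i))"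
        by (intro sum.cong refl suminf_emeasure[symmetric]) (simp_all add: sets)
      then show "(\<Sum>i. \<Sum>N\<in>\<N>. emeasure N (A i)) = (\<Sum>N\<in>\<N>. emeasure N (\<Union>i. A i))"
        by (simp add: suminf_sum)
    qed
  qed (auto simp: positive_def A)
  have "sets \<nu> = sets borel"
    unfolding \<nu>_def using sets.sigma_sets_eq[of "borel :: 'a measure"]
      by (simp add: sets_measure_of_conv)
  moreover have "emeasure \<nu> B < \<infinity>" if "B \<in> rc_borel" for B
    using that assms by (auto simp: em rc_borel_def locally_finite_borel_def)
  ultimately show ?thesis using that[of \<nu>] em by (auto simp: locally_finite_borel_def)
qed

text \<open>All four measures whose differences give \<open>\<mu>\<close> and \<open>\<mu>'\<close> are absolutely continuous with respect to
  their sum \<open>\<nu>\<close>, which is \<open>\<sigma>\<close>-finite. Their Radon--Nikodym derivatives are almost everywhere finite,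
  hence may be taken real, and can be subtracted.\<close>

lemma common_density:
  fixes \<mu> \<mu>' :: "'a::{metric_space, second_countable_topology} set \<Rightarrow> real"
  assumes lc: "locally compact (UNIV :: 'a set)" and \<mu>: "signed_borel \<mu>" and \<mu>': "signed_borel \<mu>'"
  obtains \<nu> h h' where "has_density \<mu> \<nu> h" "has_density \<mu>' \<nu> h'"
proof -
  obtain N1 N2 where N: "locally_finite_borel N1" "locally_finite_borel N2"
      "\<And>B. B \<in> rc_borel \<Longrightarrow> \<mu> B = measure N1 B - measure N2 B"
    using \<mu> unfolding signed_borel_def by blast
  obtain N1' N2' where N': "locally_finite_borel N1'" "locally_finite_borel N2'"
      "\<And>B. B \<in> rc_borel \<Longrightarrow> \<mu>' B = measure N1' B - measure N2' B"
    using \<mu>' unfolding signed_borel_def by blast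
  define \<N> where "\<N> = {N1, N2, N1', N2'}"
  have fin: "finite \<N>" and lf: "\<And>N. N \<in> \<N> \<Longrightarrow> locally_finite_borel N"
    using N N' by (auto simp: \<N>_def)
  obtain \<nu> where \<nu>: "locally_finite_borel \<nu>"
    and em: "\<And>A. A \<in> sets borel \<Longrightarrow> emeasure \<nu> A = (\<Sum>N\<in>\<N>. emeasure N A)"
    using finite_sum_locally_finite_borel[OF fin lf] by metis
  interpret \<nu>: sigma_finite_measure \<nu> by (rule sigma_finite_locally_finite_borel[OF lc \<nu>])
  have sets[measurable_cong]: "sets \<nu> = sets borel" using \<nu> by (simp add: locally_finite_borel_def)
  define h where "h N x = enn2real (RN_deriv \<nu> N x)" for N x
  have [measurable]: "h N \<in> borel_measurable borel" for N
    unfolding h_def using borel_measurable_RN_deriv[of \<nu> N] sets by (simp cong: measurable_cong_sets)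
  have int: "set_integrable \<nu> B (h N) \<and> measure N B = (LINT x:B|\<nu>. h N x)"
    if "N \<in> \<N>" and B: "B \<in> rc_borel" for N B
  proof -
    have sN: "sets N = sets \<nu>" using lf[OF that(1)] sets by (simp add: locally_finite_borel_def)
    have B'[measurable]: "B \<in> sets borel" using B by (simp add: rc_borel_def)
    have ac: "absolutely_continuous \<nu> N"
      unfolding absolutely_continuous_def
    proof
      fix A assume "A \<in> null_sets \<nu>"
      then have "A \<in> sets \<nu>" "(\<Sum>N\<in>\<N>. emeasure N A) = 0"
        using em[of A] null_setsD1[of A \<nu>] null_setsD2[of A \<nu>] by (simp_all add: sets)
      then show "A \<in> null_sets N" using that(1) fin sN by (auto simp: null_sets_def)
    qed
    have "AE x in \<nu>. RN_deriv \<nu> N x = ennreal (h N x)"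
      using \<nu>.RN_deriv_finite[OF sigma_finite_locally_finite_borel[OF lc lf[OF that(1)]] ac sN]
      by eventually_elim (simp add: h_def ennreal_enn2real_if)
    then have "density \<nu> (\<lambda>x. ennreal (h N x)) = N"
      using \<nu>.density_RN_deriv[OF ac sN]
      by (subst density_cong[of _ _ "RN_deriv \<nu> N"]) (auto elim: eventually_mono)
    then have "emeasure N B = emeasure (density \<nu> (\<lambda>x. ennreal (h N x))) B" by simp
    also have "\<dots> = (\<integral>\<^sup>+x. ennreal (h N x) * indicator B x \<partial>\<nu>)"
      by (rule emeasure_density) (auto simp: sets)
    also have "\<dots> = (\<integral>\<^sup>+x. ennreal (indicator B x * h N x) \<partial>\<nu>)"
      by (intro nn_integral_cong) (auto simp: indicator_def)
    finally have eq: "(\<integral>\<^sup>+x. ennreal (indicator B x * h N x) \<partial>\<nu>) = emeasure N B" ..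
    have fin: "emeasure N B < \<infinity>" using lf[OF that(1)] B by (auto simp: locally_finite_borel_def)
    have nn: "0 \<le> indicator B x * h N x" for x by (simp add: h_def)
    have "set_integrable \<nu> B (h N)"
      unfolding set_integrable_def using eq fin nn
      by (intro integrableI_nonneg) auto
    moreover have "(LINT x:B|\<nu>. h N x) = measure N B"
      unfolding set_lebesgue_integral_def measure_def using eq nn
      by (subst integral_eq_nn_integral) auto
    ultimately show ?thesis by simp
  qed
  have "has_density \<mu> \<nu> (\<lambda>x. h N1 x - h N2 x)" "has_density \<mu>' \<nu> (\<lambda>x. h N1' x - h N2' x)"
    unfolding has_density_def using int N(3) N'(3) by (auto simp: \<N>_def sets set_integral_diff)
  then show ?thesis by (rule that)
qed

lemma pos_variation_cong:
  "(\<And>B. B \<in> rc_borel \<Longrightarrow> \<mu> B = \<mu>' B) \<Longrightarrow> pos_variation \<mu> = pos_variation \<mu>'"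
  unfolding pos_variation_def by (metis (mono_tags, lifting) SUP_cong mem_Collect_eq)

lemma ennreal_integral_le_nn_integral:
  fixes f :: "'b \<Rightarrow> real"
  assumes "integrable M f"
  shows "ennreal (\<integral>x. f x \<partial>M) \<le> (\<integral>\<^sup>+x. ennreal (f x) \<partial>M)"
proof -
  have "ennreal (\<integral>x. f x \<partial>M) \<le> ennreal (\<integral>x. max 0 (f x) \<partial>M)"
    using assms by (intro ennreal_leI integral_mono) auto
  also have "\<dots> = (\<integral>\<^sup>+x. ennreal (max 0 (f x)) \<partial>M)"
    using assms by (intro nn_integral_eq_integral[symmetric]) auto
  also have "\<dots> = (\<integral>\<^sup>+x. ennreal (f x) \<partial>M)"
    by (intro nn_integral_cong) (auto simp: max_def ennreal_neg)
  finally show ?thesis .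
qed

text \<open>The supremum of \<open>\<integral>\<^sub>B h d\<nu>\<close> over \<open>B \<subseteq> A\<close> is approached by the sets
  \<open>A \<inter> K\<^sub>n \<inter> {h > 0}\<close> along an exhaustion \<open>K\<^sub>n\<close>. The function \<open>ennreal\<close> sends negative reals to \<open>0\<close>,
  so \<open>ennreal \<circ> h\<close> is the positive part of \<open>h\<close>.\<close>

lemma pos_variation_density:
  fixes \<mu> :: "'a::{metric_space, second_countable_topology} set \<Rightarrow> real"
  assumes lc: "locally compact (UNIV :: 'a set)" and h: "has_density \<mu> \<nu> h"
  shows "pos_variation \<mu> = density \<nu> (\<lambda>x. ennreal (h x))"
proof -
  let ?N = "density \<nu> (\<lambda>x. ennreal (h x))"
  have sets[measurable_cong]: "sets \<nu> = sets borel" and [measurable]: "h \<in> borel_measurable borel"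
    and int: "\<And>B. B \<in> rc_borel \<Longrightarrow> set_integrable \<nu> B h"
    and \<mu>: "\<And>B. B \<in> rc_borel \<Longrightarrow> \<mu> B = (LINT x:B|\<nu>. h x)"
    using h by (auto simp: has_density_def)
  obtain K :: "nat \<Rightarrow> 'a set"
    where K: "incseq K" "\<And>n. K n \<in> rc_borel" "(\<Union>n. K n) = UNIV"
    using rc_borel_exhaustion[OF lc] by metis
  have em: "emeasure ?N B = (\<integral>\<^sup>+x. ennreal (indicator B x * h x) \<partial>\<nu>)" if "B \<in> sets borel" for B
    using that by (subst emeasure_density)
      (auto simp: sets intro!: nn_integral_cong split: split_indicator)
  have eq: "(SUP B\<in>{B\<in>rc_borel. B \<subseteq> A}. ennreal (\<mu> B)) = emeasure ?N A"
    if A[measurable]: "A \<in> sets borel" for A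
  proof (rule antisym)
    show "(SUP B\<in>{B\<in>rc_borel. B \<subseteq> A}. ennreal (\<mu> B)) \<le> emeasure ?N A"
    proof (intro SUP_least)
      fix B assume B: "B \<in> {B\<in>rc_borel. B \<subseteq> A}"
      then have "ennreal (\<mu> B) \<le> (\<integral>\<^sup>+x. ennreal (indicator B x * h x) \<partial>\<nu>)"
        using ennreal_integral_le_nn_integral[of \<nu> "\<lambda>x. indicator B x * h x"] int[of B] \<mu>[of B]
        by (simp add: set_lebesgue_integral_def set_integrable_def)
      also have "\<dots> = emeasure ?N B" using B by (simp add: em rc_borel_def)
      also have "\<dots> \<le> emeasure ?N A" using B by (intro emeasure_mono) (auto simp: sets)
      finally show "ennreal (\<mu> B) \<le> emeasure ?N A" .
    qed
    have "emeasure ?N A = (SUP n. emeasure ?N (A \<inter> K n))"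
      using K by (subst SUP_emeasure_incseq)
        (auto simp: sets incseq_def rc_borel_def simp flip: Int_UN_distrib)
    also have "\<dots> \<le> (SUP B\<in>{B\<in>rc_borel. B \<subseteq> A}. ennreal (\<mu> B))"
    proof (intro SUP_least)
      fix n
      have [measurable]: "K n \<in> sets borel" using K(2)[of n] by (simp add: rc_borel_def)
      define B where "B = A \<inter> K n \<inter> {x. 0 < h x}"
      have B: "B \<in> rc_borel"
        using K(2)[of n] by (rule rc_borel_subset) (auto simp: B_def)
      have "emeasure ?N (A \<inter> K n) = (\<integral>\<^sup>+x. ennreal (indicator B x * h x) \<partial>\<nu>)"
        by (subst em) (auto intro!: nn_integral_cong simp: B_def ennreal_neg split: split_indicator)
      also have "\<dots> = ennreal (\<mu> B)"
        unfolding \<mu>[OF B] set_lebesgue_integral_def using int[OF B]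
        by (subst nn_integral_eq_integral)
          (auto simp: set_integrable_def B_def split: split_indicator)
      also have "\<dots> \<le> (SUP B\<in>{B\<in>rc_borel. B \<subseteq> A}. ennreal (\<mu> B))"
        using B by (intro SUP_upper) (auto simp: B_def)
      finally show "emeasure ?N (A \<inter> K n) \<le> (SUP B\<in>{B\<in>rc_borel. B \<subseteq> A}. ennreal (\<mu> B))" .
    qed
    finally show "emeasure ?N A \<le> (SUP B\<in>{B\<in>rc_borel. B \<subseteq> A}. ennreal (\<mu> B))" .
  qed
  have "pos_variation \<mu> = measure_of UNIV (sets (borel :: 'a measure)) (emeasure ?N)"
    unfolding pos_variation_def using sets.sigma_sets_eq[of "borel :: 'a measure"]
    by (intro measure_of_eq eq) auto
  also have "\<dots> = measure_of (space ?N) (sets ?N) (emeasure ?N)"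
    using sets_eq_imp_space_eq[OF sets] by (simp add: sets)
  finally show ?thesis by (simp only: measure_of_of_measure)
qed

lemma C_c_measurable: "f \<in> C_c \<Longrightarrow> f \<in> borel_measurable borel"
  by (simp add: C_c_def borel_measurable_continuous_onI)

lemma C_c_support: "f \<in> C_c \<Longrightarrow> {x. f x \<noteq> 0} \<in> rc_borel"
  using C_c_measurable[of f, measurable] by (simp add: C_c_def rc_borel_def)

lemma C_c_bounded:
  assumes "f \<in> C_c"
  obtains M where "0 \<le> M" "\<And>x. \<bar>f x\<bar> \<le> M"
proof -
  let ?K = "closure {x. f x \<noteq> 0}"
  have "continuous_on UNIV f" "compact ?K" using assms by (auto simp: C_c_def)
  then have "bounded (f ` ?K)"
    by (intro compact_imp_bounded compact_continuous_image) (auto intro: continuous_on_subset)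
  then obtain M where M: "\<And>x. x \<in> ?K \<Longrightarrow> \<bar>f x\<bar> \<le> M"
    unfolding bounded_iff by auto
  have "\<bar>f x\<bar> \<le> max M 0" for x
    using M[of x] closure_subset[of "{x. f x \<noteq> 0}"] by (cases "f x = 0") (auto intro: max.coboundedI1)
  then show ?thesis using that[of "max M 0"] by auto
qed

lemma signed_integral_density:
  fixes \<mu> :: "'a::{metric_space, second_countable_topology} set \<Rightarrow> real"
  assumes lc: "locally compact (UNIV :: 'a set)" and h: "has_density \<mu> \<nu> h" and f: "f \<in> C_c"
  shows "integrable \<nu> (\<lambda>x. h x * f x)" "signed_integral \<mu> f = (\<integral>x. h x * f x \<partial>\<nu>)"
proof -
  have sets[measurable_cong]: "sets \<nu> = sets borel" and [measurable]: "h \<in> borel_measurable borel"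
    and int: "\<And>B. B \<in> rc_borel \<Longrightarrow> set_integrable \<nu> B h"
    using h by (auto simp: has_density_def)
  have [measurable]: "f \<in> borel_measurable borel" by (rule C_c_measurable[OF f])
  have h': "has_density (\<lambda>B. - \<mu> B) \<nu> (\<lambda>x. - h x)"
    using h by (auto simp: has_density_def set_integrable_def set_lebesgue_integral_def)
  obtain M where M: "\<And>x. \<bar>f x\<bar> \<le> M" using C_c_bounded[OF f] by metis
  let ?S = "{x. f x \<noteq> 0}"
  have S: "integrable \<nu> (\<lambda>x. M * (indicator ?S x * h x))"
    using int[OF C_c_support[OF f]] by (simp add: set_integrable_def)
  \<comment> \<open>Needed for \<open>h\<close> and for its positive and negative parts, which are all dominated by \<open>|h|\<close>.\<close>
  have bd: "integrable \<nu> (\<lambda>x. g x * f x)"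
    if [measurable]: "g \<in> borel_measurable borel" and g: "\<And>x. \<bar>g x\<bar> \<le> \<bar>h x\<bar>" for g
  proof (rule Bochner_Integration.integrable_bound[OF S])
    have "\<bar>g x * f x\<bar> \<le> \<bar>M * (indicator ?S x * h x)\<bar>" for x
      using mult_mono[OF g[of x] order_trans[OF M[of x] abs_ge_self]]
      by (auto simp: abs_mult mult.commute split: split_indicator)
    then show "AE x in \<nu>. norm (g x * f x) \<le> norm (M * (indicator ?S x * h x))" by simp
  qed measurable
  show "integrable \<nu> (\<lambda>x. h x * f x)" by (rule bd) auto
  have ip: "integrable \<nu> (\<lambda>x. max 0 (h x) * f x)" and im: "integrable \<nu> (\<lambda>x. max 0 (- h x) * f x)"
    by (rule bd; auto)+
  have int_pos: "(\<integral>x. f x \<partial>density \<nu> (\<lambda>x. ennreal (g x))) = (\<integral>x. max 0 (g x) * f x \<partial>\<nu>)"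
    if [measurable]: "g \<in> borel_measurable borel" for g :: "'a \<Rightarrow> real"
  proof -
    have "density \<nu> (\<lambda>x. ennreal (g x)) = density \<nu> (\<lambda>x. ennreal (max 0 (g x)))"
      by (intro density_cong) (auto simp: max_def ennreal_neg)
    then show ?thesis by (simp add: integral_real_density)
  qed
  have "signed_integral \<mu> f = (\<integral>x. max 0 (h x) * f x \<partial>\<nu>) - (\<integral>x. max 0 (- h x) * f x \<partial>\<nu>)"
    unfolding signed_integral_def neg_variation_def pos_variation_density[OF lc h]
      pos_variation_density[OF lc h'] by (simp add: int_pos)
  also have "\<dots> = (\<integral>x. max 0 (h x) * f x - max 0 (- h x) * f x \<partial>\<nu>)"
    using ip im by simp
  also have "\<dots> = (\<integral>x. h x * f x \<partial>\<nu>)"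
    by (intro Bochner_Integration.integral_cong) (auto simp: max_def)
  finally show "signed_integral \<mu> f = (\<integral>x. h x * f x \<partial>\<nu>)" .
qed

text \<open>With a common reference measure for \<open>\<mu>\<close> and \<open>\<mu>'\<close>, the combination of their densities is a density
  of \<open>\<mu>''\<close>, and the claim becomes linearity of an ordinary integral.\<close>

lemma signed_integral_linear:
  fixes \<mu> :: "'a::{metric_space, second_countable_topology} set \<Rightarrow> real"
  assumes lc: "locally compact (UNIV :: 'a set)" and f: "f \<in> C_c"
    and \<mu>: "signed_borel \<mu>" and \<mu>': "signed_borel \<mu>'"
    and eq: "\<And>B. B \<in> rc_borel \<Longrightarrow> \<mu>'' B = a * \<mu> B + b * \<mu>' B"
  shows "signed_integral \<mu>'' f = a * signed_integral \<mu> f + b * signed_integral \<mu>' f"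
proof -
  obtain \<nu> h h' where h: "has_density \<mu> \<nu> h" and h': "has_density \<mu>' \<nu> h'"
    using common_density[OF lc \<mu> \<mu>'] by metis
  then have h'': "has_density \<mu>'' \<nu> (\<lambda>x. a * h x + b * h' x)"
    unfolding has_density_def by (auto simp: eq)
  note I = signed_integral_density[OF lc _ f]
  show ?thesis
    unfolding I(2)[OF h] I(2)[OF h'] I(2)[OF h'']
    using I(1)[OF h] I(1)[OF h'] by (simp add: distrib_right mult.assoc)
qed

text \<open>A non-negative set function has vanishing negative variation, so only the mass of its positive
  variation matters.\<close>

lemma signed_integral_bound:
  fixes \<mu> :: "'a::topological_space set \<Rightarrow> real"
  assumes f: "f \<in> borel_measurable borel" and M: "0 \<le> M" "\<And>x. \<bar>f x\<bar> \<le> M"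
    and pos: "\<And>B. B \<in> rc_borel \<Longrightarrow> 0 \<le> \<mu> B"
    and c: "emeasure (pos_variation \<mu>) UNIV \<le> ennreal c" "0 \<le> c"
  shows "\<bar>signed_integral \<mu> f\<bar> \<le> M * c"
proof -
  let ?P = "pos_variation \<mu>" and ?N = "neg_variation \<mu>"
  have sp: "space ?P = UNIV" and sets: "sets ?P = sets borel"
    unfolding pos_variation_def using sets.sigma_sets_eq[of "borel :: 'a measure"]
    by (simp_all add: space_measure_of_conv sets_measure_of_conv)
  have "(SUP B\<in>{B \<in> rc_borel. B \<subseteq> A}. ennreal (- \<mu> B)) = 0" for A
  proof -
    have "(SUP B\<in>{B \<in> rc_borel. B \<subseteq> A}. ennreal (- \<mu> B)) \<le> 0"
      by (intro SUP_least) (use pos in \<open>auto simp: ennreal_neg\<close>)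
    then show ?thesis by simp
  qed
  then have "emeasure ?N A = 0" for A
    unfolding neg_variation_def pos_variation_def by (simp add: emeasure_measure_of_conv)
  then have "AE x in ?N. f x = 0" by (intro AE_I[of _ _ "space ?N"]) auto
  then have N: "(\<integral>x. f x \<partial>?N) = 0" by (rule integral_eq_zero_AE)
  interpret finite_measure ?P by standard (use c sp in \<open>auto simp: top_unique\<close>)
  have "\<bar>\<integral>x. f x \<partial>?P\<bar> \<le> (\<integral>x. M \<partial>?P)"
    using M f sets
    by (intro order_trans[OF integral_abs_bound] integral_mono integrable_const_bound[of _ M])
      (auto cong: measurable_cong_sets)
  also have "\<dots> = M * measure ?P UNIV" by (simp add: sp mult.commute)
  also have "\<dots> \<le> M * c"
    using c M by (intro mult_left_mono) (auto simp: measure_def enn2real_leI)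
  finally show ?thesis by (simp add: signed_integral_def N)
qed

section \<open>Forms dominated by the energy\<close>

definition symmetric_bilinear_on ::
  "('a \<Rightarrow> real) set \<Rightarrow> (('a \<Rightarrow> real) \<Rightarrow> ('a \<Rightarrow> real) \<Rightarrow> real) \<Rightarrow> bool" where
  "symmetric_bilinear_on D Q \<longleftrightarrow>
     (\<forall>u\<in>D. \<forall>v\<in>D. Q u v = Q v u) \<and>
     (\<forall>u\<in>D. \<forall>v\<in>D. \<forall>w\<in>D. \<forall>a b. Q (\<lambda>x. a * u x + b * v x) w = a * Q u w + b * Q v w)"

lemma dirichlet_form_combination:
  "dirichlet_form m D E \<Longrightarrow> u \<in> D \<Longrightarrow> v \<in> D \<Longrightarrow> (\<lambda>x. a * u x + b * v x) \<in> D"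
  unfolding dirichlet_form_def by blast

lemma dirichlet_form_bilinear: "dirichlet_form m D E \<Longrightarrow> symmetric_bilinear_on D E"
  unfolding dirichlet_form_def symmetric_bilinear_on_def by blast

lemma dirichlet_form_nonneg: "dirichlet_form m D E \<Longrightarrow> u \<in> D \<Longrightarrow> 0 \<le> E u u"
  unfolding dirichlet_form_def by blast

lemma symmetric_bilinear_on_square:
  assumes Q: "symmetric_bilinear_on D Q" and u: "u \<in> D" and v: "v \<in> D"
    and D: "(\<lambda>x. a * u x + b * v x) \<in> D"
  shows "Q (\<lambda>x. a * u x + b * v x) (\<lambda>x. a * u x + b * v x)
    = a\<^sup>2 * Q u u + 2 * a * b * Q u v + b\<^sup>2 * Q v v"
proof -
  let ?w = "\<lambda>x. a * u x + b * v x"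
  have sym: "\<And>f g. f \<in> D \<Longrightarrow> g \<in> D \<Longrightarrow> Q f g = Q g f"
    and lin: "\<And>f. f \<in> D \<Longrightarrow> Q ?w f = a * Q u f + b * Q v f"
    using Q u v unfolding symmetric_bilinear_on_def by blast+
  have "Q u ?w = a * Q u u + b * Q u v" "Q v ?w = a * Q u v + b * Q v v"
    using lin[OF u] lin[OF v] sym[OF u D] sym[OF v D] sym[OF u v] by simp_all
  with lin[OF D] show ?thesis by (simp add: power2_eq_square algebra_simps)
qed

text \<open>A substitute for the Cauchy--Schwarz inequality: \<open>Q\<close> itself may be indefinite. Polarization of
  \<open>Q(s w \<plusminus> v)\<close> gives \<open>2 s |Q(w, v)| \<le> M (s\<^sup>2 E(w, w) + E(v, v))\<close> for all \<open>s \<ge> 0\<close>. The choice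
  \<open>s = 1 / \<parallel>w\<parallel>\<^sub>1\<close> yields the bound, and if \<open>\<parallel>w\<parallel>\<^sub>1 = 0\<close> then large \<open>s\<close> forces \<open>Q(w, v) = 0\<close>.\<close>

lemma dominated_bilinear_bounded:
  assumes df: "dirichlet_form m D E" and Q: "symmetric_bilinear_on D Q"
    and M: "0 \<le> M" "\<And>w. w \<in> D \<Longrightarrow> \<bar>Q w w\<bar> \<le> M * E w w" and v: "v \<in> D"
  obtains C where "\<And>w. w \<in> D \<Longrightarrow> \<bar>Q w v\<bar> \<le> C * norm1 m E w"
proof -
  note D = dirichlet_form_combination[OF df] and E = dirichlet_form_bilinear[OF df]
  have scaled: "2 * s * \<bar>Q w v\<bar> \<le> M * (s\<^sup>2 * E w w + E v v)" if w: "w \<in> D" and s: "0 \<le> s" for w s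
  proof -
    have "\<bar>Q (\<lambda>x. s * w x + b * v x) (\<lambda>x. s * w x + b * v x)\<bar>
        \<le> M * E (\<lambda>x. s * w x + b * v x) (\<lambda>x. s * w x + b * v x)" for b
      by (rule M(2)[OF D[OF w v]])
    from this[of 1] this[of "-1"] have
      "\<bar>s\<^sup>2 * Q w w + 2 * s * Q w v + Q v v\<bar> \<le> M * (s\<^sup>2 * E w w + 2 * s * E w v + E v v)"
      "\<bar>s\<^sup>2 * Q w w - 2 * s * Q w v + Q v v\<bar> \<le> M * (s\<^sup>2 * E w w - 2 * s * E w v + E v v)"
      unfolding symmetric_bilinear_on_square[OF Q w v D[OF w v]]
        symmetric_bilinear_on_square[OF E w v D[OF w v]] by simp_all
    then have "\<bar>2 * s * Q w v\<bar> \<le> M * (s\<^sup>2 * E w w + E v v)"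
      by (simp add: algebra_simps abs_le_iff) argo
    then show ?thesis using s by (simp add: abs_mult)
  qed
  have "\<bar>Q w v\<bar> \<le> (M * (1 + E v v)) * norm1 m E w" if w: "w \<in> D" for w
  proof -
    define r where "r = norm1 m E w"
    have "0 \<le> E w w" by (rule dirichlet_form_nonneg[OF df w])
    then have r: "0 \<le> r" "E w w \<le> r\<^sup>2"
      by (simp_all add: r_def norm1_def form1_def)
    have Ev: "0 \<le> E v v" by (rule dirichlet_form_nonneg[OF df v])
    have bound: "2 * s * \<bar>Q w v\<bar> \<le> M * (s\<^sup>2 * r\<^sup>2 + E v v)" if "0 \<le> s" for s
    proof -
      have "M * (s\<^sup>2 * E w w + E v v) \<le> M * (s\<^sup>2 * r\<^sup>2 + E v v)"
        using r M(1) by (intro mult_left_mono add_right_mono) auto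
      with scaled[OF w that] show ?thesis by linarith
    qed
    show ?thesis
    proof (cases "r = 0")
      case True
      have "\<bar>Q w v\<bar> = 0"
      proof (rule ccontr)
        assume "\<bar>Q w v\<bar> \<noteq> 0"
        then have q: "0 < \<bar>Q w v\<bar>" by simp
        have "0 \<le> M * E v v" using Ev M(1) by simp
        then show False
          using bound[of "(M * E v v + 1) / \<bar>Q w v\<bar>"] True q by simp
      qed
      then show ?thesis using True by (simp flip: r_def)
    next
      case False
      with r have "0 < r" by simp
      then have "2 * \<bar>Q w v\<bar> \<le> M * (1 + E v v) * r"
        using bound[of "1 / r"] by (simp add: field_simps)
      then show ?thesis by (simp flip: r_def)
    qed
  qed
  then show ?thesis by (rule that)
qed

text \<open>What the measures of types a, b, c have in common. For a non-negative set function on the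
  relatively compact sets, the positive variation of the whole space is its total mass.\<close>

definition dominated_form ::
  "('a::topological_space \<Rightarrow> real) set \<Rightarrow> (('a \<Rightarrow> real) \<Rightarrow> ('a \<Rightarrow> real) \<Rightarrow> real) \<Rightarrow>
   (('a \<Rightarrow> real) \<Rightarrow> ('a \<Rightarrow> real) \<Rightarrow> 'a set \<Rightarrow> real) \<Rightarrow> bool" where
  "dominated_form D E \<mu> \<longleftrightarrow>
     (\<forall>u\<in>D. \<forall>v\<in>D. signed_borel (\<mu> u v)) \<and>
     (\<forall>B\<in>rc_borel. symmetric_bilinear_on D (\<lambda>u v. \<mu> u v B) \<and> (\<forall>u\<in>D. 0 \<le> \<mu> u u B)) \<and>
     (\<forall>u\<in>D. emeasure (pos_variation (\<mu> u u)) UNIV \<le> ennreal (E u u))"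

text \<open>For a fixed test function, \<open>w \<mapsto> \<integral> f d\<mu>(w, v)\<close> is one of the functionals that define weak
  convergence.\<close>

lemma dominated_form_vague_convergence:
  fixes \<mu> :: "('a::{metric_space, second_countable_topology} \<Rightarrow> real) \<Rightarrow> _ \<Rightarrow> 'a set \<Rightarrow> real"
  assumes lc: "locally compact (UNIV :: 'a set)" and df: "dirichlet_form m D E"
    and \<mu>: "dominated_form D E \<mu>" and v: "v \<in> D" and us: "weakly_converges m D E us u"
  shows "vaguely_converges (\<lambda>n. \<mu> (us n) v) (\<mu> u v)"
  unfolding vaguely_converges_def
proof
  fix f :: "'a \<Rightarrow> real" assume f: "f \<in> C_c"
  define Q where "Q w v = signed_integral (\<mu> w v) f" for w v
  have sb: "\<And>u v. u \<in> D \<Longrightarrow> v \<in> D \<Longrightarrow> signed_borel (\<mu> u v)"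
    and bil: "\<And>B. B \<in> rc_borel \<Longrightarrow> symmetric_bilinear_on D (\<lambda>u v. \<mu> u v B)"
    using \<mu> unfolding dominated_form_def by blast+
  have Q: "symmetric_bilinear_on D Q"
    unfolding symmetric_bilinear_on_def
  proof (intro conjI ballI allI)
    fix u v assume "u \<in> D" "v \<in> D"
    with bil have "\<mu> u v B = \<mu> v u B" if "B \<in> rc_borel" for B
      using that unfolding symmetric_bilinear_on_def by blast
    then show "Q u v = Q v u"
      unfolding Q_def signed_integral_def neg_variation_def
      by (simp cong: pos_variation_cong)
  next
    fix u v w and a b :: real assume uvw: "u \<in> D" "v \<in> D" "w \<in> D"
    with bil have "\<mu> (\<lambda>x. a * u x + b * v x) w B = a * \<mu> u w B + b * \<mu> v w B"
      if "B \<in> rc_borel" for B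
      using that unfolding symmetric_bilinear_on_def by blast
    then show "Q (\<lambda>x. a * u x + b * v x) w = a * Q u w + b * Q v w"
      unfolding Q_def by (intro signed_integral_linear[OF lc f] sb uvw)
  qed
  obtain M where M: "0 \<le> M" "\<And>x. \<bar>f x\<bar> \<le> M" using C_c_bounded[OF f] by metis
  have "\<bar>Q w w\<bar> \<le> M * E w w" if "w \<in> D" for w
    unfolding Q_def using \<mu> that dirichlet_form_nonneg[OF df that]
    by (intro signed_integral_bound[OF C_c_measurable[OF f] M]) (auto simp: dominated_form_def)
  then obtain C where "\<And>w. w \<in> D \<Longrightarrow> \<bar>Q w v\<bar> \<le> C * norm1 m E w"
    using dominated_bilinear_bounded[OF df Q M(1) _ v] by metis
  moreover have "\<forall>w\<in>D. \<forall>w'\<in>D. \<forall>a b. Q (\<lambda>x. a * w x + b * w' x) v = a * Q w v + b * Q w' v"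
    using Q v unfolding symmetric_bilinear_on_def by blast
  ultimately show "(\<lambda>n. signed_integral (\<mu> (us n) v) f) \<longlonglongrightarrow> signed_integral (\<mu> u v) f"
    using us[unfolded weakly_converges_def, rule_format, of "\<lambda>w. Q w v"] unfolding Q_def by blast
qed

text \<open>The two measures are the images under \<open>p\<close> of the positive and the negative part of the weight \<open>F\<close>.\<close>

lemma signed_borel_weighted_image:
  fixes p :: "'b \<Rightarrow> 'a::topological_space" and F :: "'b \<Rightarrow> real"
  assumes p[measurable]: "p \<in> M \<rightarrow>\<^sub>M borel" and F: "integrable M F"
    and \<mu>: "\<And>B. B \<in> rc_borel \<Longrightarrow> \<mu> B = (\<integral>z. indicator B (p z) * F z \<partial>M)"
  shows "signed_borel \<mu>"
proof -
  \<comment> \<open>The image of the positive part of \<open>G\<close>, to be used for \<open>F\<close> and for \<open>-F\<close>.\<close>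
  define \<nu> where "\<nu> G = distr (density M (\<lambda>z. ennreal (max 0 (G z)))) borel p" for G :: "'b \<Rightarrow> real"
  have lf: "locally_finite_borel (\<nu> G)"
    and int: "B \<in> rc_borel \<Longrightarrow> measure (\<nu> G) B = (\<integral>z. indicator B (p z) * max 0 (G z) \<partial>M)"
    if G: "integrable M G" for G B
  proof -
    have [measurable]: "G \<in> borel_measurable M" using G by (rule borel_measurable_integrable)
    have "emeasure (\<nu> G) A < \<infinity>" if "A \<in> rc_borel" for A
    proof -
      have "emeasure (\<nu> G) A \<le> emeasure (\<nu> G) (space (\<nu> G))" by (rule emeasure_space)
      also have "\<dots> = emeasure (density M (\<lambda>z. ennreal (max 0 (G z)))) (space M)"
        unfolding \<nu>_def by (subst emeasure_distr) auto
      also have "\<dots> = (\<integral>\<^sup>+z. ennreal (max 0 (G z)) \<partial>M)"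
        by (subst emeasure_density) (auto intro!: nn_integral_cong)
      also have "\<dots> < \<infinity>" using G by (subst nn_integral_eq_integral) auto
      finally show ?thesis .
    qed
    then show "locally_finite_borel (\<nu> G)" by (simp add: locally_finite_borel_def \<nu>_def)
    assume "B \<in> rc_borel"
    then have [measurable]: "B \<in> sets borel" by (simp add: rc_borel_def)
    have "measure (\<nu> G) B = (\<integral>x. indicator B x \<partial>\<nu> G)" by (simp add: \<nu>_def)
    also have "\<dots> = (\<integral>z. indicator B (p z) * max 0 (G z) \<partial>M)"
      unfolding \<nu>_def
      by (subst integral_distr, simp, simp, subst integral_real_density) (auto simp: mult.commute)
    finally show "measure (\<nu> G) B = (\<integral>z. indicator B (p z) * max 0 (G z) \<partial>M)" .
  qed
  have [measurable]: "F \<in> borel_measurable M" using F by (rule borel_measurable_integrable)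
  have "\<mu> B = measure (\<nu> F) B - measure (\<nu> (\<lambda>z. - F z)) B" if B: "B \<in> rc_borel" for B
  proof -
    have [measurable]: "B \<in> sets borel" using B by (simp add: rc_borel_def)
    have i: "integrable M (\<lambda>z. indicator B (p z) * max 0 (G z))" if G: "integrable M G" for G :: "'b \<Rightarrow> real"
      by (rule Bochner_Integration.integrable_bound[OF G])
        (use G in \<open>auto split: split_indicator\<close>)
    have "measure (\<nu> F) B - measure (\<nu> (\<lambda>z. - F z)) B
      = (\<integral>z. indicator B (p z) * max 0 (F z) - indicator B (p z) * max 0 (- F z) \<partial>M)"
      using F i[of F] i[of "\<lambda>z. - F z"] by (simp add: int[OF _ B])
    also have "\<dots> = (\<integral>z. indicator B (p z) * F z \<partial>M)"
      by (intro Bochner_Integration.integral_cong) (auto simp: max_def split: split_indicator)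
    finally show ?thesis using \<mu>[OF B] by simp
  qed
  then show ?thesis unfolding signed_borel_def using lf F
    by (metis Bochner_Integration.integrable_minus)
qed

lemma square_integrable_product:
  fixes f g :: "'b \<Rightarrow> real"
  assumes [measurable]: "f \<in> borel_measurable M" "g \<in> borel_measurable M"
    and "integrable M (\<lambda>x. (f x)\<^sup>2)" "integrable M (\<lambda>x. (g x)\<^sup>2)"
  shows "integrable M (\<lambda>x. f x * g x)"
proof (rule Bochner_Integration.integrable_bound[of _ "\<lambda>x. (f x)\<^sup>2 + (g x)\<^sup>2"])
  have "\<bar>f x * g x\<bar> \<le> (f x)\<^sup>2 + (g x)\<^sup>2" for x
    using sum_squares_bound[of "\<bar>f x\<bar>" "\<bar>g x\<bar>"] mult_nonneg_nonneg[of "\<bar>f x\<bar>" "\<bar>g x\<bar>"]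
    unfolding abs_mult power2_abs by linarith
  then show "AE x in M. norm (f x * g x) \<le> norm ((f x)\<^sup>2 + (g x)\<^sup>2)" by simp
qed (use assms in auto)

text \<open>The common shape of \<open>mu_a\<close> (with \<open>M = k\<close>, \<open>G w\<close> the representative of \<open>w\<close> and \<open>p\<close> the identity)
  and \<open>mu_b\<close> (with \<open>M = J\<close>, \<open>G w\<close> the increment of the representative and \<open>p\<close> the first
  projection). Linearity of \<open>G\<close> almost everywhere is enough, since only integrals of products occur.\<close>

lemma dominated_form_square:
  fixes G :: "('a::topological_space \<Rightarrow> real) \<Rightarrow> 'b \<Rightarrow> real" and p :: "'b \<Rightarrow> 'a"
  assumes [measurable]: "p \<in> M \<rightarrow>\<^sub>M borel"
    and meas: "\<And>w. w \<in> D \<Longrightarrow> G w \<in> borel_measurable M"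
    and bound: "\<And>w. w \<in> D \<Longrightarrow> (\<integral>\<^sup>+z. ennreal ((G w z)\<^sup>2) \<partial>M) \<le> ennreal (E w w)"
    and D: "\<And>u v a b. u \<in> D \<Longrightarrow> v \<in> D \<Longrightarrow> (\<lambda>x. a * u x + b * v x) \<in> D"
    and lin: "\<And>u v a b. u \<in> D \<Longrightarrow> v \<in> D \<Longrightarrow>
      AE z in M. G (\<lambda>x. a * u x + b * v x) z = a * G u z + b * G v z"
    and \<mu>: "\<And>u v B. B \<in> rc_borel \<Longrightarrow> \<mu> u v B = (\<integral>z. indicator B (p z) * (G u z * G v z) \<partial>M)"
  shows "dominated_form D E \<mu>"
proof -
  have sq: "integrable M (\<lambda>z. (G w z)\<^sup>2)" if "w \<in> D" for w
    using meas[OF that] le_less_trans[OF bound[OF that] ennreal_less_top]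
    by (intro integrableI_nonneg) auto
  then have prod: "integrable M (\<lambda>z. G u z * G v z)" if "u \<in> D" "v \<in> D" for u v
    using that by (intro square_integrable_product meas)
  have "emeasure (pos_variation (\<mu> u u)) UNIV \<le> ennreal (E u u)" if u: "u \<in> D" for u
  proof -
    have "(SUP B\<in>{B \<in> rc_borel. B \<subseteq> UNIV}. ennreal (\<mu> u u B)) \<le> ennreal (E u u)"
    proof (intro SUP_least)
      fix B :: "'a set" assume "B \<in> {B \<in> rc_borel. B \<subseteq> UNIV}"
      then have B: "B \<in> rc_borel" and [measurable]: "B \<in> sets borel" by (auto simp: rc_borel_def)
      have "\<mu> u u B \<le> (\<integral>z. (G u z)\<^sup>2 \<partial>M)"
        unfolding \<mu>[OF B] using sq[OF u]
        by (intro integral_mono') (auto simp: power2_eq_square split: split_indicator)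
      then have "ennreal (\<mu> u u B) \<le> (\<integral>\<^sup>+z. ennreal ((G u z)\<^sup>2) \<partial>M)"
        using sq[OF u] by (subst nn_integral_eq_integral) (auto intro: ennreal_leI)
      with bound[OF u] show "ennreal (\<mu> u u B) \<le> ennreal (E u u)" by (rule order_trans[rotated])
    qed
    then show ?thesis unfolding pos_variation_def by (simp add: emeasure_measure_of_conv)
  qed
  moreover have "signed_borel (\<mu> u v)" if "u \<in> D" "v \<in> D" for u v
    using \<mu> by (intro signed_borel_weighted_image[OF _ prod[OF that]]) auto
  moreover have "symmetric_bilinear_on D (\<lambda>u v. \<mu> u v B)" if B: "B \<in> rc_borel" for B
    unfolding symmetric_bilinear_on_def \<mu>[OF B]
  proof (intro conjI ballI allI)
    fix u v w and a b :: real assume uvw: "u \<in> D" "v \<in> D" "w \<in> D"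
    have [measurable]: "B \<in> sets borel" using B by (simp add: rc_borel_def)
    have i: "integrable M (\<lambda>z. indicator B (p z) * (G f z * G w z))" if "f \<in> D" for f
      by (rule Bochner_Integration.integrable_bound[OF prod[OF that uvw(3)]])
        (use meas[OF that] meas[OF uvw(3)] in \<open>auto split: split_indicator\<close>)
    have "(\<integral>z. indicator B (p z) * (G (\<lambda>x. a * u x + b * v x) z * G w z) \<partial>M)
      = (\<integral>z. a * (indicator B (p z) * (G u z * G w z)) + b * (indicator B (p z) * (G v z * G w z)) \<partial>M)"
    proof (rule integral_cong_AE)
      note [measurable] = meas[OF uvw(1)] meas[OF uvw(2)] meas[OF uvw(3)] meas[OF D[OF uvw(1,2)]]
      show "(\<lambda>z. indicator B (p z) * (G (\<lambda>x. a * u x + b * v x) z * G w z)) \<in> borel_measurable M"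
        by measurable
      show "(\<lambda>z. a * (indicator B (p z) * (G u z * G w z)) + b * (indicator B (p z) * (G v z * G w z)))
        \<in> borel_measurable M" by measurable
      show "AE z in M. indicator B (p z) * (G (\<lambda>x. a * u x + b * v x) z * G w z)
        = a * (indicator B (p z) * (G u z * G w z)) + b * (indicator B (p z) * (G v z * G w z))"
        using lin[OF uvw(1,2), of a b] by eventually_elim (simp add: algebra_simps)
    qed
    then show "(\<integral>z. indicator B (p z) * (G (\<lambda>x. a * u x + b * v x) z * G w z) \<partial>M)
      = a * (\<integral>z. indicator B (p z) * (G u z * G w z) \<partial>M)
        + b * (\<integral>z. indicator B (p z) * (G v z * G w z) \<partial>M)"
      using i[OF uvw(1)] i[OF uvw(2)] by simp
  qed (simp add: mult.commute)
  moreover have "0 \<le> \<mu> u u B" if "u \<in> D" "B \<in> rc_borel" for u B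
    unfolding \<mu>[OF that(2)] by (intro integral_nonneg_AE) auto
  ultimately show ?thesis unfolding dominated_form_def by blast
qed

section \<open>Quasi-continuous representatives\<close>

text \<open>If \<open>u\<close> and \<open>v\<close> are competitors for \<open>G\<close> and \<open>H\<close>, then \<open>|u| + |v|\<close> is a competitor for the union, and
  the parallelogram inequality bounds its energy by \<open>2 E\<^sub>1(u, u) + 2 E\<^sub>1(v, v)\<close>. The constant \<open>4\<close> is
  harmless, as this serves only to show that linear combinations of quasi-continuous functions are
  quasi-continuous.\<close>

lemma qc_union_capacity:
  assumes df: "dirichlet_form m D E"
    and G: "open_capacity m D E G < ennreal e" and H: "open_capacity m D E H < ennreal e"
  shows "open_capacity m D E (G \<union> H) < ennreal (4 * e)"
proof -
  have abs: "normal_contraction (\<lambda>t. \<bar>t\<bar>)" by (auto simp: normal_contraction_def)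
  \<comment> \<open>The absolute value is a normal contraction, so competitors may be taken non-negative.\<close>
  have red: "\<exists>u. u \<in> D \<and> (AE x in m. x \<in> G \<longrightarrow> 1 \<le> u x) \<and> (\<forall>x. 0 \<le> u x) \<and> form1 m E u u < e"
    if "open_capacity m D E G < ennreal e" for G
  proof -
    have "\<exists>u\<in>{u\<in>D. AE x in m. x \<in> G \<longrightarrow> 1 \<le> u x}. ennreal (form1 m E u u) < ennreal e"
      using that unfolding open_capacity_def by (simp only: INF_less_iff)
    then obtain u
      where u: "u \<in> D" "AE x in m. x \<in> G \<longrightarrow> 1 \<le> u x" "ennreal (form1 m E u u) < ennreal e"
      by blast
    have *: "(\<lambda>x. \<bar>u x\<bar>) \<in> D" "E (\<lambda>x. \<bar>u x\<bar>) (\<lambda>x. \<bar>u x\<bar>) \<le> E u u"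
      using df abs u(1) unfolding dirichlet_form_def comp_def by blast+
    have "0 \<le> form1 m E u u" using dirichlet_form_nonneg[OF df u(1)] by (simp add: form1_def)
    then have "form1 m E u u < e" using u(3) by (simp add: ennreal_less_iff)
    then have "form1 m E (\<lambda>x. \<bar>u x\<bar>) (\<lambda>x. \<bar>u x\<bar>) < e" using *(2) by (simp add: form1_def)
    moreover have "AE x in m. x \<in> G \<longrightarrow> 1 \<le> \<bar>u x\<bar>" using u(2) by eventually_elim auto
    ultimately show ?thesis using * by (intro exI[of _ "\<lambda>x. \<bar>u x\<bar>"]) auto
  qed
  obtain u where u: "u \<in> D" "AE x in m. x \<in> G \<longrightarrow> 1 \<le> u x" "\<And>x. 0 \<le> u x" "form1 m E u u < e"
    using red[OF G] by blast
  obtain v where v: "v \<in> D" "AE x in m. x \<in> H \<longrightarrow> 1 \<le> v x" "\<And>x. 0 \<le> v x" "form1 m E v v < e"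
    using red[OF H] by blast
  define w where "w = (\<lambda>x. 1 * u x + 1 * v x)"
  have wD: "w \<in> D" unfolding w_def by (rule dirichlet_form_combination[OF df u(1) v(1)])
  have "D \<subseteq> L2 m" using df unfolding dirichlet_form_def by (elim conjE)
  with u(1) v(1) have L2: "u \<in> L2 m" "v \<in> L2 m" by auto
  have "form1 m E w w \<le> 2 * form1 m E u u + 2 * form1 m E v v"
  proof -
    have E: "E w w \<le> 2 * E u u + 2 * E v v"
    proof -
      \<comment> \<open>The defect in the inequality is the energy of \<open>u - v\<close>.\<close>
      have D': "(\<lambda>x. 1 * u x + (-1) * v x) \<in> D" by (rule dirichlet_form_combination[OF df u(1) v(1)])
      show ?thesis
        using symmetric_bilinear_on_square[OF dirichlet_form_bilinear[OF df] u(1) v(1) wD[unfolded w_def]]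
          symmetric_bilinear_on_square[OF dirichlet_form_bilinear[OF df] u(1) v(1) D']
          dirichlet_form_nonneg[OF df D'] unfolding w_def by simp
    qed
    have "(\<integral>x. w x * w x \<partial>m) \<le> (\<integral>x. 2 * (u x * u x) + 2 * (v x * v x) \<partial>m)"
    proof (rule integral_mono')
      show "integrable m (\<lambda>x. 2 * (u x * u x) + 2 * (v x * v x))"
        using L2 by (simp add: L2_def power2_eq_square)
      show "w x * w x \<le> 2 * (u x * u x) + 2 * (v x * v x)" for x
        using sum_squares_bound[of "u x" "v x"] by (simp add: w_def power2_eq_square algebra_simps)
    qed simp
    also have "\<dots> = 2 * (\<integral>x. u x * u x \<partial>m) + 2 * (\<integral>x. v x * v x \<partial>m)"
      using L2 by (simp add: L2_def power2_eq_square)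
    finally show ?thesis using E by (simp add: form1_def)
  qed
  with u(4) v(4) have "form1 m E w w < 4 * e" by simp
  moreover have "0 \<le> form1 m E w w" using dirichlet_form_nonneg[OF df wD] by (simp add: form1_def)
  ultimately have "ennreal (form1 m E w w) < ennreal (4 * e)" by (simp add: ennreal_less_iff)
  moreover have "AE x in m. x \<in> G \<union> H \<longrightarrow> 1 \<le> w x"
    using u(2) v(2)
  proof eventually_elim
    case (elim x)
    then show ?case using u(3)[of x] v(3)[of x] by (auto simp: w_def)
  qed
  ultimately show ?thesis using wD unfolding open_capacity_def by (auto simp: INF_less_iff)
qed

lemma quasi_continuous_combination:
  assumes df: "dirichlet_form m D E" and g: "quasi_continuous m D E g" and h: "quasi_continuous m D E h"
  shows "quasi_continuous m D E (\<lambda>x. a * g x + b * h x)"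
  unfolding quasi_continuous_def
proof (intro allI impI)
  fix e :: real assume "0 < e"
  then have e: "0 < e / 4" by simp
  obtain G where G: "open G" "open_capacity m D E G < ennreal (e / 4)" "continuous_on (- G) g"
    using g e unfolding quasi_continuous_def by blast
  obtain H where H: "open H" "open_capacity m D E H < ennreal (e / 4)" "continuous_on (- H) h"
    using h e unfolding quasi_continuous_def by blast
  have "open_capacity m D E (G \<union> H) < ennreal e"
    using qc_union_capacity[OF df G(2) H(2)] by simp
  moreover have "continuous_on (- (G \<union> H)) (\<lambda>x. a * g x + b * h x)"
    by (intro continuous_intros continuous_on_subset[OF G(3)] continuous_on_subset[OF H(3)]) auto
  ultimately show "\<exists>G. open G \<and> open_capacity m D E G < ennreal e \<and> continuous_on (- G) (\<lambda>x. a * g x + b * h x)"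
    using G(1) H(1) by blast
qed

lemma qc_representative_combination:
  assumes df: "dirichlet_form m D E" and "qc_representative m D E u g" "qc_representative m D E v h"
  shows "qc_representative m D E (\<lambda>x. a * u x + b * v x) (\<lambda>x. a * g x + b * h x)"
proof -
  have "AE x in m. a * g x + b * h x = a * u x + b * v x"
    using assms(2,3) unfolding qc_representative_def by auto
  then show ?thesis
    using assms quasi_continuous_combination[OF df] unfolding qc_representative_def by auto
qed

lemma nn_integral_parallelogram:
  fixes f g :: "'b \<Rightarrow> real"
  assumes [measurable]: "f \<in> borel_measurable M" "g \<in> borel_measurable M"
  shows "(\<integral>\<^sup>+x. ennreal ((f x)\<^sup>2) \<partial>M) + (\<integral>\<^sup>+x. ennreal ((g x)\<^sup>2) \<partial>M)
    = 2 * (\<integral>\<^sup>+x. ennreal (((f x + g x) / 2)\<^sup>2) \<partial>M) + 2 * (\<integral>\<^sup>+x. ennreal (((f x - g x) / 2)\<^sup>2) \<partial>M)"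
proof -
  have "ennreal ((f x)\<^sup>2) + ennreal ((g x)\<^sup>2)
    = 2 * ennreal (((f x + g x) / 2)\<^sup>2) + 2 * ennreal (((f x - g x) / 2)\<^sup>2)" for x
  proof -
    have "2 * ennreal (((f x + g x) / 2)\<^sup>2) + 2 * ennreal (((f x - g x) / 2)\<^sup>2)
      = ennreal (2 * ((f x + g x) / 2)\<^sup>2 + 2 * ((f x - g x) / 2)\<^sup>2)"
      by (simp add: ennreal_mult)
    also have "2 * ((f x + g x) / 2)\<^sup>2 + 2 * ((f x - g x) / 2)\<^sup>2 = (f x)\<^sup>2 + (g x)\<^sup>2"
      by (simp add: power2_eq_square field_simps)
    finally show ?thesis by simp
  qed
  then show ?thesis by (simp flip: nn_integral_add nn_integral_cmult)
qed

lemma jump_measurable: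
  fixes J :: "('a::{metric_space, second_countable_topology} \<times> 'a) measure" and g :: "'a \<Rightarrow> real"
  assumes J: "radon_measure_on (UNIV - diag) J" and g: "g \<in> borel_measurable borel"
  shows "fst \<in> J \<rightarrow>\<^sub>M borel" "(\<lambda>z. g (fst z) - g (snd z)) \<in> borel_measurable J"
proof -
  have sets: "sets J = sets (restrict_space borel (UNIV - diag))"
    using J by (simp add: radon_measure_on_def)
  have [measurable]: "fst \<in> J \<rightarrow>\<^sub>M borel" "snd \<in> J \<rightarrow>\<^sub>M borel"
    unfolding measurable_cong_sets[OF sets refl]
    by (intro measurable_restrict_space1 borel_measurable_continuous_onI continuous_intros)+
  show "fst \<in> J \<rightarrow>\<^sub>M borel" by measurable
  have "(\<lambda>z. g (fst z)) \<in> borel_measurable J" "(\<lambda>z. g (snd z)) \<in> borel_measurable J"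
    by (rule measurable_compose[OF _ g], measurable)+
  then show "(\<lambda>z. g (fst z) - g (snd z)) \<in> borel_measurable J" by simp
qed

lemma beurling_deny_formula:
  assumes "beurling_deny m D E k J \<mu>c" "u \<in> D" "qc_representative m D E u g"
  shows "ennreal (E u u) = (\<integral>\<^sup>+z. ennreal ((g (fst z) - g (snd z))\<^sup>2) \<partial>J) +
    emeasure (pos_variation (\<mu>c u u)) UNIV + (\<integral>\<^sup>+x. ennreal ((g x)\<^sup>2) \<partial>k)"
  using assms unfolding beurling_deny_def by (simp add: case_prod_beta')

text \<open>Write \<open>A\<close> and \<open>B\<close> for the jump and the killing energy of a function. The average \<open>(g + h) / 2\<close> also
  represents \<open>w\<close>, and the strongly local part \<open>P\<close> of the formula depends on \<open>w\<close> alone, so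
  \<open>A + P + B = E(w, w)\<close> for \<open>g\<close>, \<open>h\<close> and their average. The parallelogram identity then leaves
  \<open>A((g - h) / 2) = B((g - h) / 2) = 0\<close>. The cancellation is legitimate because \<open>E(w, w)\<close> is
  finite.\<close>

lemma qc_representatives_agree:
  fixes k :: "'a::{metric_space, second_countable_topology} measure"
  assumes df: "dirichlet_form m D E" and bd: "beurling_deny m D E k J \<mu>c" and w: "w \<in> D"
    and g: "qc_representative m D E w g" and h: "qc_representative m D E w h"
  shows "AE x in k. g x = h x" "AE z in J. g (fst z) - g (snd z) = h (fst z) - h (snd z)"
proof -
  have J: "radon_measure_on (UNIV - diag) J" and k: "sets k = sets borel"
    using bd by (auto simp: beurling_deny_def radon_measure_on_def)
  have g': "g \<in> borel_measurable borel" and h': "h \<in> borel_measurable borel"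
    using g h by (auto simp: qc_representative_def)
  then have [measurable]: "g \<in> borel_measurable k" "h \<in> borel_measurable k"
    using k by (auto cong: measurable_cong_sets)
  define \<Delta> where "\<Delta> f z = f (fst z) - f (snd z)" for f :: "'a \<Rightarrow> real" and z
  have [measurable]: "\<Delta> g \<in> borel_measurable J" "\<Delta> h \<in> borel_measurable J"
    unfolding \<Delta>_def using jump_measurable(2)[OF J] g' h' by auto
  let ?c = "\<lambda>x. (g x + h x) / 2" and ?d = "\<lambda>x. (g x - h x) / 2"
  have c: "qc_representative m D E w ?c"
    using qc_representative_combination[OF df g h, of "1/2" "1/2"] by (simp add: add_divide_distrib)
  have \<Delta>: "\<Delta> ?c z = (\<Delta> g z + \<Delta> h z) / 2" "\<Delta> ?d z = (\<Delta> g z - \<Delta> h z) / 2" for z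
    by (simp_all add: \<Delta>_def field_simps)
  define A where "A f = (\<integral>\<^sup>+z. ennreal ((\<Delta> f z)\<^sup>2) \<partial>J)" for f
  define B where "B f = (\<integral>\<^sup>+x. ennreal ((f x)\<^sup>2) \<partial>k)" for f :: "'a \<Rightarrow> real"
  define P where "P = emeasure (pos_variation (\<mu>c w w)) UNIV"
  have E: "ennreal (E w w) = A f + P + B f" if "qc_representative m D E w f" for f
    using beurling_deny_formula[OF bd w that] by (simp add: A_def B_def P_def \<Delta>_def)
  have par: "A g + A h = 2 * A ?c + 2 * A ?d" "B g + B h = 2 * B ?c + 2 * B ?d"
    using nn_integral_parallelogram[of "\<Delta> g" J "\<Delta> h"] nn_integral_parallelogram[of g k h]
    by (simp_all add: A_def B_def \<Delta>)
  have "2 * ennreal (E w w) + 0 = ennreal (E w w) + ennreal (E w w)" by (simp add: mult_2)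
  also have "\<dots> = (A g + P + B g) + (A h + P + B h)" using E[OF g] E[OF h] by simp
  also have "\<dots> = (A g + A h) + 2 * P + (B g + B h)" unfolding mult_2 by (simp only: ac_simps)
  also have "\<dots> = 2 * (A ?c + P + B ?c) + (2 * A ?d + 2 * B ?d)"
    unfolding par by (simp add: distrib_left ac_simps)
  also have "\<dots> = 2 * ennreal (E w w) + (2 * A ?d + 2 * B ?d)" using E[OF c] by simp
  finally have "2 * A ?d + 2 * B ?d = 0"
    unfolding ennreal_add_left_cancel by (auto simp: ennreal_mult_eq_top_iff)
  then have 0: "A ?d = 0" "B ?d = 0" by auto
  from 0(1) have "AE z in J. ennreal (((\<Delta> g z - \<Delta> h z) / 2)\<^sup>2) = 0"
    unfolding A_def \<Delta> by (subst (asm) nn_integral_0_iff_AE) auto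
  then show "AE z in J. g (fst z) - g (snd z) = h (fst z) - h (snd z)"
    by eventually_elim (simp add: \<Delta>_def ennreal_eq_0_iff)
  from 0(2) have "AE x in k. ennreal ((?d x)\<^sup>2) = 0"
    unfolding B_def by (subst (asm) nn_integral_0_iff_AE) auto
  then show "AE x in k. g x = h x"
    by eventually_elim (simp add: ennreal_eq_0_iff)
qed

section \<open>Vague convergence\<close>

theorem proposition2p2:
  fixes m k :: "'a::{metric_space, second_countable_topology} measure"
    and D :: "('a \<Rightarrow> real) set"
    and E :: "('a \<Rightarrow> real) \<Rightarrow> ('a \<Rightarrow> real) \<Rightarrow> real"
    and J :: "('a \<times> 'a) measure"
    and \<mu>c :: "('a \<Rightarrow> real) \<Rightarrow> ('a \<Rightarrow> real) \<Rightarrow> 'a set \<Rightarrow> real"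
    and qc :: "('a \<Rightarrow> real) \<Rightarrow> 'a \<Rightarrow> real"
    and us :: "nat \<Rightarrow> 'a \<Rightarrow> real" and u v :: "'a \<Rightarrow> real"
  assumes "locally compact (UNIV :: 'a set)"
    and "radon_measure_on UNIV m" and "full_support m"
    and "regular_dirichlet_form m D E"
    and "beurling_deny m D E k J \<mu>c"
    and "\<And>w. w \<in> D \<Longrightarrow> qc_representative m D E w (qc w)"
    and "\<And>n. us n \<in> D" and "\<And>n. Linf_norm m (us n) < \<infinity>"
    and "u \<in> D" and "Linf_norm m u < \<infinity>"
    and "v \<in> D"
    and "\<exists>C::real. \<forall>n. Linf_norm m (us n) \<le> ereal C"
    and "weakly_converges m D E us u"
  shows "vaguely_converges (\<lambda>n. mu_a k qc (us n) v) (mu_a k qc u v) \<and>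
         vaguely_converges (\<lambda>n. mu_b J qc (us n) v) (mu_b J qc u v) \<and>
         vaguely_converges (\<lambda>n. \<mu>c (us n) v) (\<mu>c u v) \<and>
         vaguely_converges (\<lambda>n. mu_d J \<mu>c qc (us n) v) (mu_d J \<mu>c qc u v)"
proof -
  note lc = assms(1) and bd = assms(5) and qc = assms(6)
  have df: "dirichlet_form m D E" using assms(4) by (simp add: regular_dirichlet_form_def)
  have J: "radon_measure_on (UNIV - diag) J" and k: "sets k = sets borel"
    and \<mu>c: "measure_valued_form m D \<mu>c"
    using bd by (auto simp: beurling_deny_def radon_measure_on_def)
  have qc_meas: "qc w \<in> borel_measurable borel" if "w \<in> D" for w
    using qc[OF that] by (simp add: qc_representative_def)
  note BD = beurling_deny_formula[OF bd _ qc]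
  note D = dirichlet_form_combination[OF df]
  have agree: "AE x in k. qc (\<lambda>x. a * f x + b * g x) x = a * qc f x + b * qc g x"
    "AE z in J. qc (\<lambda>x. a * f x + b * g x) (fst z) - qc (\<lambda>x. a * f x + b * g x) (snd z)
      = (a * qc f (fst z) + b * qc g (fst z)) - (a * qc f (snd z) + b * qc g (snd z))"
    if "f \<in> D" "g \<in> D" for f g a b
    using qc_representatives_agree[OF df bd D[OF that] qc[OF D[OF that]]
        qc_representative_combination[OF df qc[OF that(1)] qc[OF that(2)]], of a b] by simp_all

  have a: "dominated_form D E (mu_a k qc)"
  proof (rule dominated_form_square[where G = qc and p = "\<lambda>x. x" and M = k])
    show "(\<integral>\<^sup>+x. ennreal ((qc w x)\<^sup>2) \<partial>k) \<le> ennreal (E w w)" if "w \<in> D" for w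
      unfolding BD[OF that that] by simp
    show "mu_a k qc u v B = (\<integral>x. indicator B x * (qc u x * qc v x) \<partial>k)" for u v B
      by (simp add: mu_a_def set_lebesgue_integral_def)
  qed (use k qc_meas D agree(1) in \<open>auto cong: measurable_cong_sets\<close>)

  have b: "dominated_form D E (mu_b J qc)"
  proof (rule dominated_form_square[where G = "\<lambda>w z. qc w (fst z) - qc w (snd z)" and p = fst and M = J])
    show "(\<integral>\<^sup>+z. ennreal ((qc w (fst z) - qc w (snd z))\<^sup>2) \<partial>J) \<le> ennreal (E w w)" if "w \<in> D" for w
      unfolding BD[OF that that] by (simp add: add.assoc)
    have "space J = UNIV - diag"
      using J sets_eq_imp_space_eq[of J] by (simp add: radon_measure_on_def space_restrict_space)
    then show "mu_b J qc u v B = (\<integral>z. indicator B (fst z) *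
        ((qc u (fst z) - qc u (snd z)) * (qc v (fst z) - qc v (snd z))) \<partial>J)" for u v B
      unfolding mu_b_def set_lebesgue_integral_def
      by (intro Bochner_Integration.integral_cong) (auto split: split_indicator)
    show "fst \<in> J \<rightarrow>\<^sub>M borel" by (rule jump_measurable(1)[OF J borel_measurable_const[of 0]])
    show "AE z in J. qc (\<lambda>x. s * f x + t * g x) (fst z) - qc (\<lambda>x. s * f x + t * g x) (snd z)
      = s * (qc f (fst z) - qc f (snd z)) + t * (qc g (fst z) - qc g (snd z))"
      if "f \<in> D" "g \<in> D" for f g s t
      using agree(2)[OF that, of s t] by eventually_elim (simp add: algebra_simps)
  qed (use jump_measurable(2)[OF J] qc_meas D in auto)

  have c: "dominated_form D E \<mu>c"
    unfolding dominated_form_def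
  proof (intro conjI ballI)
    show "signed_borel (\<mu>c u v)" if "u \<in> D" "v \<in> D" for u v
      using \<mu>c that by (simp add: measure_valued_form_def signed_radon_imp_signed_borel)
    show "symmetric_bilinear_on D (\<lambda>u v. \<mu>c u v B)" if "B \<in> rc_borel" for B
      using \<mu>c that unfolding measure_valued_form_def symmetric_bilinear_on_def by blast
    show "0 \<le> \<mu>c u u B" if "B \<in> rc_borel" "u \<in> D" for u B
      using \<mu>c that unfolding measure_valued_form_def by blast
    show "emeasure (pos_variation (\<mu>c u u)) UNIV \<le> ennreal (E u u)" if "u \<in> D" for u
      unfolding BD[OF that that] by (simp add: add.assoc add_increasing add_increasing2)
  qed

  note conv = dominated_form_vague_convergence[OF lc df _ assms(11) assms(13)]
  have sum: "signed_integral (mu_d J \<mu>c qc w v) f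
      = signed_integral (mu_b J qc w v) f + signed_integral (\<mu>c w v) f"
    if "w \<in> D" "f \<in> C_c" for w f
    using signed_integral_linear[OF lc that(2), of "mu_b J qc w v" "\<mu>c w v" "mu_d J \<mu>c qc w v" 1 1]
      b c that(1) assms(11) by (simp add: mu_d_def dominated_form_def)
  have "vaguely_converges (\<lambda>n. mu_d J \<mu>c qc (us n) v) (mu_d J \<mu>c qc u v)"
    using conv[OF b] conv[OF c] assms(7,9)
    unfolding vaguely_converges_def by (auto simp: sum intro!: tendsto_add)
  with conv[OF a] conv[OF b] conv[OF c] show ?thesis by blast
qed

end
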